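(* For every positive integer $n\neq 11$, \[K(n)=\left\lfloor \frac n6\right\rfloor+\left\lfloor\frac{n+4}6\right\rfloor+1,\] and $K(11)=5$.
   Context: Words are finite strings over the two-letter alphabet $\{a,b\}$; concatenation is the product of words. The length of a word $w$ is $l(w)$. A word $w=a_0\dots a_n$ is a palindrome (symmetric) if $a_i=a_{n-i}$ for all $i\le n$. For a nonempty word $w$, $m(w)$ denotes the minimal number $k$ such that $w=p_1p_2\cdots p_k$ with $p_1,\dots,p_k$ nonempty palindromes. For a positive integer $n$, $K(n)=\max\{m(w): w \text{ a binary word with } l(w)=n\}$. *)

theory Defs
  imports Main
begin

datatype letter = A | B

type_synonym word = "letter list"

definition palindrome :: "word \<Rightarrow> bool" where
  "palindrome w \<longleftrightarrow> (\<forall>i < length w. w ! i = w ! (length w - 1 - i))"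

lemma palindrome_iff_rev: "palindrome w \<longleftrightarrow> rev w = w"
proof -
  have "rev w = w \<longleftrightarrow> (\<forall>i < length w. rev w ! i = w ! i)"
    by (simp add: list_eq_iff_nth_eq)
  also have "\<dots> \<longleftrightarrow> (\<forall>i < length w. w ! (length w - 1 - i) = w ! i)"
    by (intro all_cong) (simp add: rev_nth)
  also have "\<dots> \<longleftrightarrow> palindrome w"
    unfolding palindrome_def by metis
  finally show ?thesis
    by blast
qed

definition palindromic_factorization :: "word list \<Rightarrow> word \<Rightarrow> bool" where
  "palindromic_factorization ps w \<longleftrightarrow>
     concat ps = w \<and> (\<forall>p \<in> set ps. p \<noteq> [] \<and> palindrome p)"

definition m :: "word \<Rightarrow> nat" where
  "m w = (LEAST k. \<exists>ps. length ps = k \<and> palindromic_factorization ps w)"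

definition K :: "nat \<Rightarrow> nat" where
  "K n = Max {m w | w. length w = n}"

text \<open>The minimum and the maximum above are attained: every word factors into
  its letters, and there are finitely many words of each length.\<close>

lemma palindromic_factorization_exists:
  "\<exists>ps. length ps = length w \<and> palindromic_factorization ps w"
proof (intro exI conjI)
  show "palindromic_factorization (map (\<lambda>x. [x]) w) w"
    by (auto simp: palindromic_factorization_def palindrome_def)
qed simp

lemma m_attained: "\<exists>ps. length ps = m w \<and> palindromic_factorization ps w"
  unfolding m_def by (rule LeastI_ex) (use palindromic_factorization_exists in blast)

lemma m_le: "palindromic_factorization ps w \<Longrightarrow> m w \<le> length ps"
  unfolding m_def by (rule Least_le) blast

lemma finite_words: "finite {w :: word. length w = n}"
proof -
  have "(UNIV :: letter set) = {A, B}"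
    using letter.exhaust by auto
  then have "finite (UNIV :: letter set)"
    by (metis finite.emptyI finite.insertI)
  from finite_lists_length_eq[OF this, of n] show ?thesis
    by simp
qed

lemma K_range: "finite {m w | w. length w = n}" "{m w | w. length w = n} \<noteq> {}"
proof -
  show "finite {m w | w. length w = n}"
    using finite_imageI[OF finite_words, of m n] by (simp add: image_Collect)
  have "m (replicate n A) \<in> {m w | w. length w = n}"
    by (auto intro!: exI[of _ "replicate n A"])
  then show "{m w | w. length w = n} \<noteq> {}"
    by blast
qed

end

theory Submission
  imports Defs
begin

text \<open>
  Write \<open>f(n) = n div 6 + (n + 4) div 6 + 1\<close>, so that \<open>f(n + 6) = f(n) + 2\<close>.

  Upper bound. By induction, every nonempty word satisfies \<open>m(w) \<le> f(|w|)\<close>, except for four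
  words of length 11. If a prefix of length \<open>d\<close> is a product of \<open>c\<close> palindromes with
  \<open>c + f(n - d) \<le> f(n)\<close>, it can be cut off. Whether this happens depends only on \<open>n mod 6\<close>, so
  for each residue one searches the tree of all prefixes. The search is infinite only along one
  branch (up to exchanging the letters), \<open>aababbb(aababb)\<^sup>\<infinity>\<close>, where the search state recurs
  after each period with 6 letters and 2 palindromes more; hence a finite search suffices.

  Lower bound. The same branch is extremal: the prefix of length \<open>i > 0\<close> of
  \<open>aababbb(aababb)\<^sup>\<infinity>\<close> needs \<open>i div 3 + 1\<close> palindromes, which is \<open>f(i)\<close> unless \<open>i mod 6 = 2\<close>,
  and in the remaining case \<open>aababbb(aababb)\<^sup>k aaababb\<close> is extremal. These words contain no
  palindrome longer than 5, so that here, too, finitely many states have to be computed.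
\<close>

section \<open>Palindromic length\<close>

lemma m_Nil [simp]: "m [] = 0"
  using m_le[of "[]" "[]"] by (simp add: palindromic_factorization_def)

lemma m_append_le: "m (u @ v) \<le> m u + m v"
proof -
  obtain ps qs where "length ps = m u" "palindromic_factorization ps u"
    "length qs = m v" "palindromic_factorization qs v"
    using m_attained by meson
  then show ?thesis
    using m_le[of "ps @ qs" "u @ v"] by (auto simp: palindromic_factorization_def)
qed

lemma m_palindrome_le: "rev p = p \<Longrightarrow> m p \<le> 1"
  by (cases "p = []")
    (use m_le[of "[p]" p] in \<open>auto simp: palindromic_factorization_def palindrome_iff_rev\<close>)

text \<open>The recursion behind the lower bound: dropping the last factor of a minimal
  factorization strictly lowers \<open>m\<close>.\<close>

lemma m_split_last:
  assumes "w \<noteq> []"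
  obtains u p where "w = u @ p" "p \<noteq> []" "rev p = p" "m u < m w"
proof -
  obtain ps where ps: "length ps = m w" "palindromic_factorization ps w"
    using m_attained by blast
  then have "ps \<noteq> []"
    using assms by (auto simp: palindromic_factorization_def)
  then obtain qs p where "ps = qs @ [p]"
    by (metis rev_exhaust)
  with ps show ?thesis
    using m_le[of qs "concat qs"]
    by (intro that[of "concat qs" p])
      (auto simp: palindromic_factorization_def palindrome_iff_rev)
qed

section \<open>Exchanging the two letters\<close>

fun flip :: "letter \<Rightarrow> letter" where
  "flip A = B"
| "flip B = A"

lemma flip_flip [simp]: "flip (flip x) = x"
  by (cases x) auto

lemma map_flip_flip [simp]: "map flip (map flip w) = w"
  by (induction w) auto

lemma m_map_flip_le: "m (map flip w) \<le> m w"
proof -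
  obtain ps where "length ps = m w" "palindromic_factorization ps w"
    using m_attained by blast
  then show ?thesis
    using m_le[of "map (map flip) ps" "map flip w"]
    by (auto simp: palindromic_factorization_def palindrome_iff_rev rev_map map_concat)
qed

lemma m_map_flip [simp]: "m (map flip w) = m w"
  by (metis m_map_flip_le map_flip_flip order_antisym)

section \<open>Search states\<close>

text \<open>Over the integers because arguments are taken only up to multiples of 6 and may be
  negative, as \<open>\<rho> - l\<close> in \<open>cuttable\<close>.\<close>

definition bound :: "int \<Rightarrow> int" where
  "bound x = x div 6 + (x + 4) div 6 + 1"

lemma bound_shift [simp]: "bound (x + 6 * j) = bound x + 2 * j"
  by (simp add: bound_def)

text \<open>A state \<open>(r, cs, l)\<close> describes a prefix \<open>p\<close> of a word up to a shift \<open>j\<close>: its last letters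
  in reversed order are \<open>r\<close>, its length is \<open>l + 6 * j\<close>, and \<open>cs ! i + 2 * j\<close> is the (bound for
  the) palindromic length of \<open>p\<close> without its last \<open>i\<close> letters.\<close>

type_synonym state = "word \<times> int list \<times> int"

text \<open>Minimizes over the last palindromic factor. Numbering starts at 1 since
  \<open>cs ! i\<close> remains after removing a factor of length \<open>i + 1\<close> that includes
  the new letter.\<close>

definition next_cost :: "word \<Rightarrow> int list \<Rightarrow> int" where
  "next_cost r cs =
     1 + Min (set (map snd (filter (\<lambda>(k, c). rev (take k r) = take k r) (enumerate 1 cs))))"

fun advance :: "letter \<Rightarrow> state \<Rightarrow> state" where
  "advance x (r, cs, l) = (x # r, next_cost (x # r) cs # cs, l + 1)"

fun final_le :: "state \<Rightarrow> bool" where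
  "final_le (r, cs, l) \<longleftrightarrow> hd cs \<le> bound l"

text \<open>Six letters cost two palindromes, hence \<open>div 3\<close>. The second state may
  record fewer letters and costs than the first.\<close>

fun recurs :: "state \<Rightarrow> state \<Rightarrow> bool" where
  "recurs (r, cs, l) (r', cs', l') \<longleftrightarrow>
     take (length r') r = r' \<and> (l - l') mod 6 = 0 \<and>
     take (length cs') cs = map (\<lambda>c. c + (l - l') div 3) cs'"

definition start :: state where
  "start = ([], [0], 0)"

text \<open>The state after \<open>aababbb(aababb)\<^sup>k\<close> for \<open>k > 0\<close>.\<close>

definition steady :: state where
  "steady = ([B,B,A,B,A,A,B], [5,5,4,4,4,3], 13)"

lemma next_cost_set:
  "set (map snd (filter (\<lambda>(k, c). rev (take k r) = take k r) (enumerate 1 cs))) =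
     {cs ! i | i. i < length cs \<and> rev (take (Suc i) r) = take (Suc i) r}"
proof -
  have "(k, c) \<in> set (enumerate 1 cs) \<longleftrightarrow> (\<exists>i < length cs. k = Suc i \<and> c = cs ! i)" for k c
    unfolding in_set_enumerate_eq by (cases k) auto
  then show ?thesis
    by (force simp: image_iff)
qed

lemma next_cost_le:
  "i < length cs \<Longrightarrow> rev (take (Suc i) r) = take (Suc i) r \<Longrightarrow> next_cost r cs \<le> 1 + cs ! i"
  unfolding next_cost_def next_cost_set by (auto intro!: Min_le)

lemma next_cost_attained:
  assumes "cs \<noteq> []" "r \<noteq> []"
  obtains i where "i < length cs" "rev (take (Suc i) r) = take (Suc i) r"
    "next_cost r cs = 1 + cs ! i"
proof -
  let ?S = "{cs ! i | i. i < length cs \<and> rev (take (Suc i) r) = take (Suc i) r}"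
  have "cs ! 0 \<in> ?S"
    using assms by (cases r) auto
  then have "Min ?S \<in> ?S"
    by (intro Min_in) auto
  then show ?thesis
    using that unfolding next_cost_def next_cost_set by auto
qed

lemma recursE:
  assumes "recurs (r, cs, l) (r', cs', l')"
  obtains k q where "l = l' + 6 * k" "rev r = q @ rev r'" "length cs' \<le> length cs"
    "\<And>i. i < length cs' \<Longrightarrow> cs ! i = cs' ! i + 2 * k"
proof -
  from assms have "6 dvd l - l'"
    by auto
  then obtain k where "l - l' = 6 * k"
    by (rule dvdE)
  then have k: "l = l' + 6 * k"
    by simp
  then have cs: "take (length cs') cs = map (\<lambda>c. c + 2 * k) cs'"
    and r: "take (length r') r = r'"
    using assms by auto
  show ?thesis
  proof
    show "rev r = rev (drop (length r') r) @ rev r'"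
      using r by (metis append_take_drop_id rev_append)
    show "length cs' \<le> length cs"
      using arg_cong[OF cs, of length] by simp
    show "cs ! i = cs' ! i + 2 * k" if "i < length cs'" for i
      using arg_cong[OF cs, of "\<lambda>xs. xs ! i"] that by simp
  qed (fact k)
qed

section \<open>Upper bound\<close>

definition exceptional :: "word list" where
  "exceptional =
     [[A,A,B,A,B,B,A,A,B,A,B], [A,B,A,B,B,A,A,B,A,B,B],
      [B,B,A,B,A,A,B,B,A,B,A], [B,A,B,A,A,B,B,A,B,A,A]]"

definition bounded :: "word \<Rightarrow> bool" where
  "bounded w \<longleftrightarrow> w \<in> set exceptional \<or> int (m w) \<le> bound (int (length w))"

lemma bounded_map_flip [simp]: "bounded (map flip w) \<longleftrightarrow> bounded w"
proof -
  have "map flip w \<in> set exceptional" if "w \<in> set exceptional" for w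
    using that by (auto simp: exceptional_def)
  then have "map flip w \<in> set exceptional \<longleftrightarrow> w \<in> set exceptional"
    by (metis map_flip_flip)
  then show ?thesis
    by (simp add: bounded_def)
qed

text \<open>In the following definitions, nested conditionals are used instead of propositional
  connectives because they are evaluated lazily.\<close>

fun cuttable :: "int \<Rightarrow> state \<Rightarrow> bool" where
  "cuttable \<rho> (r, cs, l) \<longleftrightarrow>
     (if bound \<rho> < hd cs + bound (\<rho> - l) then False
      else if (l + 11 - \<rho>) mod 6 = 0
      then list_all (\<lambda>e. final_le (fold advance e (r, cs, l))) exceptional
      else True)"

fun admissible :: "int \<Rightarrow> state \<Rightarrow> bool" where
  "admissible \<rho> (r, cs, l) \<longleftrightarrow>
     (if (l - \<rho>) mod 6 = 0
      then if final_le (r, cs, l) then True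
           else if l = 11 then rev r \<in> set exceptional else False
      else True)"

fun closes :: "nat \<Rightarrow> int \<Rightarrow> state \<Rightarrow> bool" where
  "closes 0 \<rho> s \<longleftrightarrow> False"
| "closes (Suc k) \<rho> s \<longleftrightarrow>
     (if admissible \<rho> s
      then if cuttable \<rho> s then True
           else if recurs s steady then True
           else if closes k \<rho> (advance A s) then closes k \<rho> (advance B s) else False
      else False)"

text \<open>The costs are upper bounds, so forgetting letters or costs is harmless. While
  \<open>l \<le> 11\<close> the whole prefix is kept, so that exceptional words can be
  recognized.\<close>

fun above :: "state \<Rightarrow> word \<Rightarrow> bool" where
  "above (r, cs, l) p \<longleftrightarrow>
     r \<noteq> [] \<and> cs \<noteq> [] \<and> length cs \<le> Suc (length r) \<and> (l \<le> 11 \<longrightarrow> p = rev r) \<and>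
     (\<exists>j q. p = q @ rev r \<and> int (length p) = l + 6 * j \<and>
        (\<forall>i < length cs. int (m (take (length p - i) p)) \<le> cs ! i + 2 * j))"

text \<open>The suffix attaining \<open>next_cost\<close> lies within the known letters because
  \<open>cs\<close> has at most one entry more than \<open>r\<close>; subadditivity of
  \<open>m\<close> does the rest.\<close>

lemma above_advance:
  assumes "above s p"
  shows "above (advance x s) (p @ [x])"
proof -
  obtain r cs l where s: "s = (r, cs, l)"
    by (cases s)
  from assms obtain j q where q: "p = q @ rev r" and l: "int (length p) = l + 6 * j"
    and cs: "cs \<noteq> []" "length cs \<le> Suc (length r)" and r: "r \<noteq> []" "l \<le> 11 \<longrightarrow> p = rev r"
    and cost: "\<And>i. i < length cs \<Longrightarrow> int (m (take (length p - i) p)) \<le> cs ! i + 2 * j"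
    unfolding s by auto
  obtain i where i: "i < length cs" "rev (take (Suc i) (x # r)) = take (Suc i) (x # r)"
    "next_cost (x # r) cs = 1 + cs ! i"
    using next_cost_attained[of cs "x # r"] cs by blast
  have "p @ [x] = take (length p - i) p @ rev (take (Suc i) (x # r))"
    using i(1) cs q by (simp add: rev_take)
  then have "m (p @ [x]) \<le> m (take (length p - i) p) + m (rev (take (Suc i) (x # r)))"
    by (metis m_append_le)
  moreover have "m (rev (take (Suc i) (x # r))) \<le> 1"
    by (metis i(2) m_palindrome_le)
  ultimately have new: "int (m (p @ [x])) \<le> next_cost (x # r) cs + 2 * j"
    using cost[OF i(1)] i(3) by simp
  have "int (m (take (length (p @ [x]) - k) (p @ [x]))) \<le> (next_cost (x # r) cs # cs) ! k + 2 * j"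
    if "k < Suc (length cs)" for k
    using that new cost by (cases k) auto
  then show ?thesis
    using q l cs r unfolding s by (auto intro!: exI[of _ j])
qed

lemma above_fold: "above s p \<Longrightarrow> above (fold advance w s) (p @ w)"
proof (induction w arbitrary: s p)
  case (Cons x w)
  from Cons.IH[OF above_advance[OF Cons.prems, of x]] show ?case
    by simp
qed simp

lemma above_final: "above s p \<Longrightarrow> final_le s \<Longrightarrow> int (m p) \<le> bound (int (length p))"
  by (cases s) (auto simp: hd_conv_nth dest!: spec[of _ 0])

lemma above_steady:
  assumes "above s p" "recurs s steady"
  shows "above steady p"
proof -
  obtain r cs l where s: "s = (r, cs, l)"
    by (cases s)
  obtain r' cs' l' where t: "steady = (r', cs', l')"
    by (cases steady)
  from assms obtain j q where q: "p = q @ rev r" and l: "int (length p) = l + 6 * j"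
    and cost: "\<And>i. i < length cs \<Longrightarrow> int (m (take (length p - i) p)) \<le> cs ! i + 2 * j"
    unfolding s by auto
  from assms(2) obtain k q' where k: "l = l' + 6 * k" and q': "rev r = q' @ rev r'"
    and cs: "length cs' \<le> length cs" "\<And>i. i < length cs' \<Longrightarrow> cs ! i = cs' ! i + 2 * k"
    unfolding s t by (rule recursE) blast
  have "p = (q @ q') @ rev r'"
    using q q' by simp
  moreover have "int (m (take (length p - i) p)) \<le> cs' ! i + 2 * (j + k)"
    if "i < length cs'" for i
    using cost[of i] cs that by simp
  moreover have "r' \<noteq> []" "cs' \<noteq> []" "length cs' \<le> Suc (length r')" "\<not> l' \<le> 11"
    using t by (auto simp: steady_def)
  ultimately show ?thesis
    using l k unfolding t by (auto intro!: exI[of _ "j + k"])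
qed

lemma length_exceptional: "e \<in> set exceptional \<Longrightarrow> length e = 11"
  by (auto simp: exceptional_def)

text \<open>Subadditivity works unless the rest \<open>x\<close> is exceptional and violates the
  bound. For such \<open>x\<close>, which have length 11, \<open>cuttable\<close> has run the search
  through all of \<open>x\<close>.\<close>

lemma bounded_if_cuttable:
  assumes "above s p" "cuttable \<rho> s" "bounded x" "(int (length (p @ x)) - \<rho>) mod 6 = 0"
  shows "bounded (p @ x)"
proof -
  obtain r cs l where s: "s = (r, cs, l)"
    by (cases s)
  from assms(1) obtain j where l: "int (length p) = l + 6 * j" and "int (m p) \<le> hd cs + 2 * j"
    unfolding s by (auto simp: hd_conv_nth dest!: spec[of _ 0])
  moreover from assms(4) obtain t where t: "int (length (p @ x)) = \<rho> + 6 * t"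
    by (metis add.commute diff_add_cancel mod_0_imp_dvd dvdE)
  ultimately have x: "int (length x) = \<rho> - l + 6 * (t - j)"
    by simp
  show ?thesis
  proof (cases "x \<in> set exceptional")
    case True
    then have "l + 11 - \<rho> = 6 * (t - j)"
      using x length_exceptional by fastforce
    then have "final_le (fold advance x s)"
      using assms(2) True unfolding s by (auto simp: list_all_iff split: if_splits)
    then show ?thesis
      using above_final[OF above_fold[OF assms(1)]] by (simp add: bounded_def)
  next
    case False
    then have "int (m x) \<le> bound (\<rho> - l) + 2 * (t - j)"
      using assms(3) x by (metis bounded_def bound_shift)
    moreover have "hd cs + bound (\<rho> - l) \<le> bound \<rho>"
      using assms(2) unfolding s by (auto split: if_splits)
    moreover have "int (m (p @ x)) \<le> int (m p) + int (m x)"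
      using m_append_le[of p x] by linarith
    ultimately have "int (m (p @ x)) \<le> bound \<rho> + 2 * t"
      using \<open>int (m p) \<le> hd cs + 2 * j\<close> by simp
    then show ?thesis
      unfolding bounded_def t by simp
  qed
qed

text \<open>Treats words that end at the current node of the search.\<close>

lemma bounded_if_admissible:
  assumes "above s p" "admissible \<rho> s" "(int (length p) - \<rho>) mod 6 = 0"
  shows "bounded p"
proof -
  obtain r cs l where s: "s = (r, cs, l)"
    by (cases s)
  from assms(1) obtain j where "int (length p) = l + 6 * j"
    unfolding s by auto
  with assms(3) have "(l - \<rho>) mod 6 = 0"
    by presburger
  then have "final_le s \<or> l = 11 \<and> rev r \<in> set exceptional"
    using assms(2) unfolding s by (auto split: if_splits)
  then show ?thesis
    using above_final[OF assms(1)] assms(1) unfolding s by (auto simp: bounded_def)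
qed

text \<open>Induction on the search depth. The word ends, or is cut and the hypothesis on shorter
  words applies, or the branch reaches \<open>steady\<close>; the last hypothesis postpones that
  case.\<close>

lemma bounded_if_closes:
  assumes "closes k \<rho> s" "above s p" "(int (length (p @ x)) - \<rho>) mod 6 = 0"
    and "\<And>v. v \<noteq> [] \<Longrightarrow> length v < length (p @ x) \<Longrightarrow> bounded v"
    and "\<And>p' x'. p' @ x' = p @ x \<Longrightarrow> length x' \<le> length x \<Longrightarrow> above steady p' \<Longrightarrow> bounded (p @ x)"
  shows "bounded (p @ x)"
  using assms
proof (induction k arbitrary: s p x)
  case (Suc k)
  have adm: "admissible \<rho> s"
    using Suc.prems(1) by (auto split: if_splits)
  have "p \<noteq> []"
    using Suc.prems(2) by (cases s) auto
  show ?case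
  proof (cases x)
    case Nil
    then show ?thesis
      using bounded_if_admissible[OF Suc.prems(2) adm] Suc.prems(3) by simp
  next
    case (Cons y ys)
    consider "cuttable \<rho> s" | "recurs s steady"
      | "closes k \<rho> (advance A s)" "closes k \<rho> (advance B s)"
      using Suc.prems(1) by (auto split: if_splits)
    then show ?thesis
    proof cases
      case 1
      then show ?thesis
        using bounded_if_cuttable[OF Suc.prems(2) 1 _ Suc.prems(3)] Suc.prems(4)[of x]
          \<open>p \<noteq> []\<close> Cons by simp
    next
      case 2
      then show ?thesis
        using Suc.prems(5)[OF refl] above_steady[OF Suc.prems(2)] by simp
    next
      case 3
      then have "closes k \<rho> (advance y s)"
        by (cases y) auto
      from Suc.IH[OF this above_advance[OF Suc.prems(2)], of ys]
      have "bounded ((p @ [y]) @ ys)"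
        using Suc.prems(3,4,5) Cons by simp
      then show ?thesis
        using Cons by simp
    qed
  qed
qed simp

section \<open>The finite searches, one for each residue of the length modulo 6\<close>

lemma closes_small_residues:
  "list_all (\<lambda>\<rho>. closes 30 \<rho> ([A], [1, 0], 1) \<and>
     closes 30 \<rho> (advance A steady) \<and> closes 30 \<rho> (advance B steady)) [0, 1, 2, 3, 4]"
  by code_simp

lemma closes_residue_5_start: "closes 30 5 ([A], [1, 0], 1)"
  by code_simp

lemma closes_residue_5_steady:
  "closes 30 5 (advance A steady) \<and> closes 30 5 (advance B steady)"
  by code_simp

lemma closes_residues:
  assumes "\<rho> \<in> {0..5}"
  shows "closes 30 \<rho> ([A], [1, 0], 1)" "closes 30 \<rho> (advance y steady)"
proof -
  have "\<rho> = 0 \<or> \<rho> = 1 \<or> \<rho> = 2 \<or> \<rho> = 3 \<or> \<rho> = 4 \<or> \<rho> = 5"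
    using assms by auto
  then show "closes 30 \<rho> ([A], [1, 0], 1)" "closes 30 \<rho> (advance y steady)"
    using closes_small_residues closes_residue_5_start closes_residue_5_steady
    by (cases y; auto simp del: closes.simps)+
qed

text \<open>Induction on the number of letters still to be read, which drops between visits to
  \<open>steady\<close>.\<close>

lemma bounded_if_above_steady:
  assumes "above steady p" "\<And>v. v \<noteq> [] \<Longrightarrow> length v < length (p @ x) \<Longrightarrow> bounded v"
  shows "bounded (p @ x)"
  using assms
proof (induction "length x" arbitrary: p x rule: less_induct)
  case less
  show ?case
  proof (cases x)
    case Nil
    have "final_le steady"
      by (simp add: steady_def bound_def)
    then show ?thesis
      using above_final[OF less.prems(1)] Nil by (simp add: bounded_def)
  next
    case (Cons y ys)
    define \<rho> where "\<rho> = int (length (p @ x)) mod 6"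
    \<comment> \<open>One letter is read first: \<open>steady\<close> recurs to itself, so a search
      from it could close without progress.\<close>
    have "closes 30 \<rho> (advance y steady)"
      by (rule closes_residues) (simp add: \<rho>_def)
    then have "bounded ((p @ [y]) @ ys)"
    proof (rule bounded_if_closes)
      show "above (advance y steady) (p @ [y])"
        using less.prems(1) by (rule above_advance)
      show "(int (length ((p @ [y]) @ ys)) - \<rho>) mod 6 = 0"
        unfolding \<rho>_def Cons by simp
      show "bounded v" if "v \<noteq> []" "length v < length ((p @ [y]) @ ys)" for v
        using less.prems(2) that Cons by simp
      show "bounded ((p @ [y]) @ ys)"
        if "p' @ x' = (p @ [y]) @ ys" "length x' \<le> length ys" "above steady p'" for p' x'
        using less.hyps[of x' p'] less.prems(2) that Cons by simp
    qed
    then show ?thesis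
      using Cons by simp
  qed
qed

theorem bounded_word: "w \<noteq> [] \<Longrightarrow> bounded w"
proof (induction "length w" arbitrary: w rule: less_induct)
  case less
  have bounded_A: "bounded ([A] @ x)" if len: "length ([A] @ x) = length w" for x
  proof -
    define \<rho> where "\<rho> = int (length ([A] @ x)) mod 6"
    have "closes 30 \<rho> ([A], [1, 0], 1)"
      by (rule closes_residues) (simp add: \<rho>_def)
    then show ?thesis
    proof (rule bounded_if_closes)
      have "m [A] \<le> 1"
        by (rule m_palindrome_le) simp
      then show "above ([A], [1, 0], 1) [A]"
        by (auto simp: less_Suc_eq intro!: exI[of _ 0])
      show "(int (length ([A] @ x)) - \<rho>) mod 6 = 0"
        unfolding \<rho>_def by simp
      show "bounded v" if "v \<noteq> []" "length v < length ([A] @ x)" for v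
        using less.hyps that len by simp
      show "bounded ([A] @ x)" if "p' @ x' = [A] @ x" "above steady p'" for p' x'
        using bounded_if_above_steady[OF that(2), of x'] less.hyps len unfolding that(1) by simp
    qed
  qed
  from less.prems obtain y x where w: "w = [y] @ x"
    by (cases w) auto
  show ?case
  proof (cases y)
    case A
    then show ?thesis
      using bounded_A[of x] w by simp
  next
    case B
    then have "map flip w = [A] @ map flip x"
      using w by simp
    then have "bounded (map flip w)"
      using bounded_A[of "map flip x"] w by simp
    then show ?thesis
      by simp
  qed
qed

section \<open>Lower bound\<close>

definition palindromes_at_most :: "nat \<Rightarrow> word \<Rightarrow> bool" where
  "palindromes_at_most h w \<longleftrightarrow> (\<forall>u t v. w = u @ t @ v \<longrightarrow> rev t = t \<longrightarrow> length t \<le> h)"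

definition no_long_palindrome :: "nat \<Rightarrow> word \<Rightarrow> bool" where
  "no_long_palindrome h r \<longleftrightarrow>
     (\<forall>k \<in> {Suc h, Suc (Suc h)}. k \<le> length r \<longrightarrow> rev (take k r) \<noteq> take k r)"

text \<open>Removing both ends of a palindrome leaves a palindrome, so only the two lengths following
  \<open>h\<close> need to be checked.\<close>

lemma palindromes_at_most_snoc:
  assumes "palindromes_at_most h p" "p = q @ rev r" "q = [] \<or> h < length r"
    and "no_long_palindrome h (x # r)"
  shows "palindromes_at_most h (p @ [x])"
  unfolding palindromes_at_most_def
proof (intro allI impI)
  fix u t v
  assume eq: "p @ [x] = u @ t @ v" and t: "rev t = t"
  show "length t \<le> h"
  proof (cases v rule: rev_cases)
    case Nil
    show ?thesis
    proof (rule ccontr)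
      assume long: "\<not> length t \<le> h"
      have "length t \<le> Suc (Suc h)"
      proof (cases t)
        case (Cons y t')
        show ?thesis
        proof (cases t' rule: rev_cases)
          case (snoc t'' z)
          have "p = (u @ [y]) @ t'' @ []"
            using eq unfolding Nil Cons snoc by simp
          moreover have "rev t'' = t''"
            using t unfolding Cons snoc by simp
          ultimately have "length t'' \<le> h"
            by (rule assms(1)[unfolded palindromes_at_most_def, rule_format])
          then show ?thesis
            using Cons snoc by simp
        qed (use Cons in simp)
      qed simp
      with long have k: "length t \<in> {Suc h, Suc (Suc h)}"
        by auto
      have split: "(x # r) @ rev q = t @ rev u"
        using arg_cong[OF eq, of rev] t Nil assms(2) by simp
      \<comment> \<open>Either \<open>r\<close> is all of \<open>p\<close> reversed, or
        \<open>x # r\<close> has at least \<open>h + 2\<close> letters.\<close>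
      have len: "length t \<le> length (x # r)"
        using assms(3) k arg_cong[OF split, of length] by auto
      have "take (length t) ((x # r) @ rev q) = t"
        unfolding split by simp
      then have "take (length t) (x # r) = t"
        using len unfolding take_append by simp
      then show False
        using assms(4)[unfolded no_long_palindrome_def, rule_format, OF k len] t by simp
    qed
  next
    case (snoc v' z)
    then have "p = u @ t @ v'"
      using eq by simp
    then show ?thesis
      using t by (rule assms(1)[unfolded palindromes_at_most_def, rule_format])
  qed
qed

text \<open>For lower bounds no candidate may be missed: either the full history is kept, or
  \<open>h\<close> costs are, which cover every last factor of length 1 to \<open>h\<close>.\<close>

fun below :: "nat \<Rightarrow> state \<Rightarrow> word \<Rightarrow> bool" where
  "below h (r, cs, l) p \<longleftrightarrow>
     cs \<noteq> [] \<and> length cs \<le> Suc (length r) \<and> palindromes_at_most h p \<and>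
     (\<exists>j q. p = q @ rev r \<and> int (length p) = l + 6 * j \<and>
        (q = [] \<and> length cs = Suc (length r) \<or> h < length r \<and> h \<le> length cs) \<and>
        (\<forall>i < length cs. cs ! i + 2 * j \<le> int (m (take (length p - i) p))))"

lemma below_start: "below h start []"
  by (auto simp: start_def palindromes_at_most_def)

text \<open>The last factor of a minimal factorization has length at most \<open>h\<close>, hence is
  among the candidates of \<open>next_cost\<close>.\<close>

lemma below_advance:
  assumes "below h s p" "no_long_palindrome h (x # fst s)"
  shows "below h (advance x s) (p @ [x])"
proof -
  obtain r cs l where s: "s = (r, cs, l)"
    by (cases s)
  from assms obtain j q where q: "p = q @ rev r" and l: "int (length p) = l + 6 * j"
    and cs: "cs \<noteq> []" "length cs \<le> Suc (length r)" and pal: "palindromes_at_most h p"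
    and h: "q = [] \<and> length cs = Suc (length r) \<or> h < length r \<and> h \<le> length cs"
    and cost: "\<And>i. i < length cs \<Longrightarrow> cs ! i + 2 * j \<le> int (m (take (length p - i) p))"
    unfolding s by auto
  have pal': "palindromes_at_most h (p @ [x])"
    using palindromes_at_most_snoc[OF pal q] h assms(2) unfolding s by auto
  obtain u t where ut: "p @ [x] = u @ t" "t \<noteq> []" "rev t = t" "m u < m (p @ [x])"
    by (rule m_split_last[of "p @ [x]"]) auto
  define i where "i = length t - 1"
  have i: "length t = Suc i"
    using ut(2) by (simp add: i_def)
  have "length t \<le> h"
    using pal' ut unfolding palindromes_at_most_def by (metis append_Nil2)
  moreover have "length t \<le> Suc (length p)"
    using arg_cong[OF ut(1), of length] by simp
  ultimately have "i < length cs"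
    using h i q by auto
  have "rev t @ rev u = x # r @ rev q"
    using arg_cong[OF ut(1), of rev] q by simp
  then have "take (Suc i) (x # r @ rev q) = t"
    using i ut(3) by (metis append_eq_conv_conj)
  moreover have "take (Suc i) (x # r @ rev q) = take (Suc i) (x # r)"
    using \<open>i < length cs\<close> cs by simp
  ultimately have "rev (take (Suc i) (x # r)) = take (Suc i) (x # r)"
    using ut(3) by metis
  then have "next_cost (x # r) cs \<le> 1 + cs ! i"
    using next_cost_le \<open>i < length cs\<close> by blast
  moreover have "u = take (length p - i) p"
  proof -
    have "length u = length p - i"
      using arg_cong[OF ut(1), of length] i by simp
    moreover have "u = take (length u) (p @ [x])"
      unfolding ut(1) by simp
    ultimately show ?thesis
      by simp
  qed
  ultimately have new: "next_cost (x # r) cs + 2 * j \<le> int (m (p @ [x]))"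
    using cost[OF \<open>i < length cs\<close>] ut(4) by simp
  have "(next_cost (x # r) cs # cs) ! k + 2 * j \<le> int (m (take (length (p @ [x]) - k) (p @ [x])))"
    if "k < Suc (length cs)" for k
    using that new cost by (cases k) auto
  then show ?thesis
    using q l cs h pal' unfolding s by (auto intro!: exI[of _ j])
qed

fun safe :: "nat \<Rightarrow> state \<Rightarrow> word \<Rightarrow> bool" where
  "safe h s [] \<longleftrightarrow> True"
| "safe h s (x # w) \<longleftrightarrow> no_long_palindrome h (x # fst s) \<and> safe h (advance x s) w"

lemma below_fold: "below h s p \<Longrightarrow> safe h s w \<Longrightarrow> below h (fold advance w s) (p @ w)"
proof (induction w arbitrary: s p)
  case (Cons x w)
  then have "below h (advance x s) (p @ [x])" "safe h (advance x s) w"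
    using below_advance by auto
  from Cons.IH[OF this] show ?case
    by simp
qed simp

fun final_ge :: "state \<Rightarrow> bool" where
  "final_ge (r, cs, l) \<longleftrightarrow> bound l \<le> hd cs"

lemma below_hd:
  assumes "below h s p" "int (length p) = snd (snd s) + 6 * j"
  shows "hd (fst (snd s)) + 2 * j \<le> int (m p)"
  using assms by (cases s) (auto simp: hd_conv_nth dest!: spec[of _ 0])

lemma below_final: "below h s p \<Longrightarrow> final_ge s \<Longrightarrow> bound (int (length p)) \<le> int (m p)"
  by (cases s) (auto simp: hd_conv_nth dest!: spec[of _ 0])

lemma below_steady:
  assumes "below 5 s p" "recurs s steady"
  shows "below 5 steady p"
proof -
  obtain r cs l where s: "s = (r, cs, l)"
    by (cases s)
  obtain r' cs' l' where t: "steady = (r', cs', l')"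
    by (cases steady)
  from assms obtain j q where q: "p = q @ rev r" and l: "int (length p) = l + 6 * j"
    and pal: "palindromes_at_most 5 p"
    and cost: "\<And>i. i < length cs \<Longrightarrow> cs ! i + 2 * j \<le> int (m (take (length p - i) p))"
    unfolding s by auto
  from assms(2) obtain k q' where k: "l = l' + 6 * k" and q': "rev r = q' @ rev r'"
    and cs: "length cs' \<le> length cs" "\<And>i. i < length cs' \<Longrightarrow> cs ! i = cs' ! i + 2 * k"
    unfolding s t by (rule recursE) blast
  have "p = (q @ q') @ rev r'"
    using q q' by simp
  moreover have "cs' ! i + 2 * (j + k) \<le> int (m (take (length p - i) p))"
    if "i < length cs'" for i
    using cost[of i] cs that by simp
  moreover have "cs' \<noteq> []" "length cs' \<le> Suc (length r')" "5 < length r'" "5 \<le> length cs'"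
    using t by (auto simp: steady_def)
  ultimately show ?thesis
    using l k pal unfolding t by (auto intro!: exI[of _ "j + k"])
qed

section \<open>The extremal words\<close>

definition period :: word where
  "period = [A,A,B,A,B,B]"

definition periodic_word :: "nat \<Rightarrow> word" where
  "periodic_word k = [A,A,B,A,B,B,B] @ concat (replicate (Suc k) period)"

lemma length_periodic_word: "length (periodic_word k) = 13 + 6 * k"
  by (induction k) (auto simp: periodic_word_def period_def)

text \<open>Base and induction step for \<open>below_periodic_word\<close>.\<close>

lemma recurs_period:
  "safe 5 start (periodic_word 0) \<and> recurs (fold advance (periodic_word 0) start) steady"
  "safe 5 steady period \<and> recurs (fold advance period steady) steady"
  by code_simp+

lemma periodic_word_Suc: "periodic_word (Suc k) = periodic_word k @ period"
proof -
  have "concat (replicate (Suc (Suc k)) period) = concat (replicate (Suc k) period @ [period])"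
    by (simp only: replicate_append_same replicate_Suc[of "Suc k"])
  also have "\<dots> = concat (replicate (Suc k) period) @ period"
    by (simp only: concat_append concat.simps append_Nil2)
  finally show ?thesis
    by (simp only: periodic_word_def append.assoc)
qed

lemma below_periodic_word: "below 5 steady (periodic_word k)"
proof (induction k)
  case 0
  have "below 5 (fold advance (periodic_word 0) start) ([] @ periodic_word 0)"
    by (rule below_fold[OF below_start conjunct1[OF recurs_period(1)]])
  then show ?case
    unfolding append_Nil by (rule below_steady[OF _ conjunct2[OF recurs_period(1)]])
next
  case (Suc k)
  have "below 5 (fold advance period steady) (periodic_word k @ period)"
    by (rule below_fold[OF Suc conjunct1[OF recurs_period(2)]])
  then show ?case
    unfolding periodic_word_Suc by (rule below_steady[OF _ conjunct2[OF recurs_period(2)]])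
qed

text \<open>With 13 letters before them, the lengths 0, 2, 3, 4, 5, 7 cover all residues modulo 6.
  Length 7 replaces 1, where continuing the period falls one short of the bound.\<close>

definition tails :: "word list" where
  "tails = [[], [A,A], [A,A,B], [A,A,B,A], [A,A,B,A,B], [A,A,A,B,A,B,B]]"

lemma final_ge_tails:
  "list_all (\<lambda>v. safe 5 steady v \<and> final_ge (fold advance v steady)) tails"
  by code_simp

text \<open>The lengths 1 to 12 and 14 are those not of the form \<open>13 + 6 * k + d\<close> with
  \<open>d\<close> the length of a tail.\<close>

definition short_words :: "word list" where
  "short_words =
     [[A], [A,B], [A,A,B], [A,A,B,A], [A,A,B,A,B], [A,A,B,A,B,B], [A,A,B,A,B,B,B],
      [A,A,B,A,B,B,A,A], [A,A,B,A,B,B,B,A,A], [A,A,B,A,B,B,B,A,A,B], [A,A,B,A,B,B,B,A,A,B,A],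
      [A,A,B,A,B,B,B,A,A,B,A,B], [A,A,B,A,B,B,B,A,A,A,B,A,B,B]]"

text \<open>No word here exceeds 14 letters, so \<open>safe 14\<close> is automatic and the states
  keep the full history.\<close>

lemma final_ge_short_words:
  "list_all (\<lambda>w. safe 14 start w \<and> final_ge (fold advance w start)) short_words"
  by code_simp

lemma exists_word_ge_bound:
  assumes "n > 0"
  obtains w where "length w = n" "bound (int n) \<le> int (m w)"
proof (cases "n \<le> 12 \<or> n = 14")
  case True
  then have "n \<in> {1,2,3,4,5,6,7,8,9,10,11,12,14}"
    using assms by simp presburger
  then have "n \<in> length ` set short_words"
    by (auto simp: short_words_def)
  then obtain w where w: "w \<in> set short_words" "length w = n"
    by auto
  then have "safe 14 start w" "final_ge (fold advance w start)"
    using final_ge_short_words by (simp_all add: list_all_iff)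
  then have "bound (int (length ([] @ w))) \<le> int (m ([] @ w))"
    by (intro below_final[OF below_fold[OF below_start]])
  then show ?thesis
    using that[of w] w(2) by simp
next
  case False
  then have "\<exists>k. \<exists>d \<in> {0, 2, 3, 4, 5, 7}. n = 13 + 6 * k + d"
    by simp presburger
  then obtain k d where n: "n = 13 + 6 * k + d" and "d \<in> {0, 2, 3, 4, 5, 7}"
    by blast
  then have "d \<in> length ` set tails"
    by (auto simp: tails_def)
  with n obtain v where v: "v \<in> set tails" "length (periodic_word k @ v) = n"
    by (auto simp: length_periodic_word)
  then have "safe 5 steady v" "final_ge (fold advance v steady)"
    using final_ge_tails by (simp_all add: list_all_iff)
  then have "bound (int (length (periodic_word k @ v))) \<le> int (m (periodic_word k @ v))"
    by (intro below_final[OF below_fold[OF below_periodic_word]])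
  then show ?thesis
    using that[OF v(2)] unfolding v(2) by blast
qed

text \<open>Since \<open>bound 11 = 4\<close>, the cost is read from the state itself, with shift
  0.\<close>

lemma exceptional_word_ge: "5 \<le> m [A,A,B,A,B,B,A,A,B,A,B]"
proof -
  let ?w = "[A,A,B,A,B,B,A,A,B,A,B]"
  let ?s = "fold advance ?w start"
  have run: "safe 11 start ?w" "int (length ([] @ ?w)) = snd (snd ?s) + 6 * 0"
    "5 \<le> hd (fst (snd ?s))"
    by code_simp+
  have "hd (fst (snd ?s)) + 2 * 0 \<le> int (m ([] @ ?w))"
    by (rule below_hd[OF below_fold[OF below_start run(1)] run(2)])
  with run(3) have "5 \<le> int (m ?w)"
    unfolding append_Nil by linarith
  then show ?thesis
    by linarith
qed

section \<open>The values of \<open>K\<close>\<close>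

lemma K_eqI:
  assumes "\<And>w. length w = n \<Longrightarrow> m w \<le> k" "length w = n" "k \<le> m w"
  shows "K n = k"
  unfolding K_def
proof (rule Max_eqI)
  show "k \<in> {m w |w. length w = n}"
    using assms by (auto intro!: exI[of _ w] order_antisym)
qed (use assms(1) K_range in auto)

theorem theorem1:
  shows "(\<forall>n::nat. n > 0 \<and> n \<noteq> 11 \<longrightarrow> K n = n div 6 + (n + 4) div 6 + 1) \<and> K 11 = 5"
proof (intro conjI allI impI)
  have bound: "bound (int n) = int (n div 6 + (n + 4) div 6 + 1)" for n
    by (simp add: bound_def of_nat_div)
  have upper: "m w \<le> n div 6 + (n + 4) div 6 + 1" if "length w = n" "n > 0" "n \<noteq> 11" for w n
  proof -
    have "w \<notin> set exceptional" "w \<noteq> []"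
      using that length_exceptional by auto
    then show ?thesis
      using bounded_word[of w] that(1) unfolding bounded_def bound by (auto simp only: of_nat_le_iff)
  qed
  show "K n = n div 6 + (n + 4) div 6 + 1" if "n > 0 \<and> n \<noteq> 11" for n
  proof -
    from that have "n > 0" "n \<noteq> 11"
      by simp_all
    from \<open>n > 0\<close> obtain w where w: "length w = n" "bound (int n) \<le> int (m w)"
      by (rule exists_word_ge_bound)
    show ?thesis
    proof (rule K_eqI)
      show "m v \<le> n div 6 + (n + 4) div 6 + 1" if "length v = n" for v
        using upper[OF that \<open>n > 0\<close> \<open>n \<noteq> 11\<close>] .
      show "n div 6 + (n + 4) div 6 + 1 \<le> m w"
        using w(2) unfolding bound of_nat_le_iff .
    qed (fact w(1))
  qed
  show "K 11 = 5"
  proof (rule K_eqI[OF _ _ exceptional_word_ge])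
    fix w :: word
    assume "length w = 11"
    \<comment> \<open>The formula gives 4 for length 10, and the first letter adds at most
      1.\<close>
    then obtain x v where w: "w = [x] @ v" "length v = 10"
      by (cases w) auto
    then have "m v \<le> 4"
      using upper[of v 10] by simp
    then show "m w \<le> 5"
      using m_append_le[of "[x]" v] m_palindrome_le[of "[x]"] w by simp
  qed simp
qed

end
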